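(* Let $L$ be a finite distributive lattice and let $I,J\subseteq L$ be order ideals (each either lower or upper). (a) If $I,J$ are both lower order ideals or both upper order ideals, then $$|I|\cdot|J|\le |I\cap J|\cdot|L|.$$ (b) If one of $I,J$ is a lower order ideal and the other is an upper order ideal, then $$|I|\cdot|J|\ge |I\cap J|\cdot|L|.$$
   Context: A lower order ideal in a poset $(P,\preceq)$ is a subset $I\subseteq P$ such that $x\in I$ and $y\preceq x$ imply $y\in I$. An upper order ideal is a subset $J\subseteq P$ such that $x\in J$ and $y\succeq x$ imply $y\in J$. A lattice is a poset in which every pair $x,y$ has a meet $x\wedge y$ (greatest lower bound) and a join $x\vee y$ (least upper bound); it is distributive if $x\wedge(y\vee z)=(x\wedge y)\vee(x\wedge z)$ for all $x,y,z$. $|S|$ denotes the cardinality of a set $S$. *)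

theory Defs
  imports Main
begin

definition lower_order_ideal :: "'a::order set \<Rightarrow> bool" where
  "lower_order_ideal I \<longleftrightarrow> (\<forall>x y. x \<in> I \<longrightarrow> y \<le> x \<longrightarrow> y \<in> I)"

definition upper_order_ideal :: "'a::order set \<Rightarrow> bool" where
  "upper_order_ideal J \<longleftrightarrow> (\<forall>x y. x \<in> J \<longrightarrow> x \<le> y \<longrightarrow> y \<in> J)"

end

theory Submission
  imports Defs
begin

text \<open>
  For two lower ideals the inequality says that, under the uniform distribution on a finite
  distributive lattice, the events \<open>I\<close> and \<open>J\<close> are positively correlated. It is proved for all
  finite sublattices \<open>S\<close> by induction on \<open>card S\<close>, without representing the lattice by sets.

  Let \<open>m\<close> be a coatom of \<open>S\<close>. It splits \<open>S\<close> into the sublattice \<open>S0\<close> of the elements below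
  \<open>m\<close> and the rest \<open>S1\<close>. The elements \<open>x\<close> of \<open>S1\<close> satisfy \<open>sup x m = t\<close>, where \<open>t\<close> is the top of
  \<open>S\<close>, so distributivity makes \<open>S1\<close> a sublattice as well, and makes \<open>x \<mapsto> inf x m\<close> injective
  on \<open>S1\<close>, with an upper set of \<open>S0\<close> as its image (lemmas \<open>sublattice_not_below_coatom\<close>,
  \<open>inf_coatom_inj_on\<close> and \<open>inf_coatom_image\<close>). This map sends \<open>I \<inter> S1\<close> into \<open>I \<inter> S0\<close>, and
  the induction hypothesis in \<open>S0\<close>, applied to \<open>I\<close> and the complement of the image, shows that
  the image contains at most its proportional share of \<open>I \<inter> S0\<close>. Therefore \<open>I\<close> is at most
  as dense in \<open>S1\<close> as in \<open>S0\<close> (lemma \<open>density_above_coatom_le\<close>), and likewise \<open>J\<close>. The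
  densities of \<open>I\<close> and \<open>J\<close> being ordered in the same way on the two parts,
  Chebyshev's sum inequality (lemma \<open>chebyshev_two_blocks\<close>) glues the inequalities in \<open>S0\<close> and
  \<open>S1\<close> to the one in \<open>S\<close>.

  The cases with upper ideals follow by complementation, which exchanges lower and upper ideals
  and turns positive into negative correlation.
\<close>

section \<open>Complements and correlation\<close>

lemma lower_order_ideal_Compl: "lower_order_ideal (- J) \<longleftrightarrow> upper_order_ideal J"
  unfolding lower_order_ideal_def upper_order_ideal_def by blast

text \<open>
  Replacing one of two events by its complement changes the sign of their covariance.
\<close>

lemma card_correlation_Compl:
  assumes "finite S"
  shows "card (I \<inter> S) * card (- J \<inter> S) \<le> card (I \<inter> - J \<inter> S) * card S
     \<longleftrightarrow> card (I \<inter> J \<inter> S) * card S \<le> card (I \<inter> S) * card (J \<inter> S)"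
proof -
  have I: "card (I \<inter> S) = card (I \<inter> J \<inter> S) + card (I \<inter> - J \<inter> S)"
    using assms by (subst card_Un_disjoint[symmetric]) (auto intro!: arg_cong[where f = card])
  have S: "card S = card (J \<inter> S) + card (- J \<inter> S)"
    using assms by (subst card_Un_disjoint[symmetric]) (auto intro!: arg_cong[where f = card])
  show ?thesis
    unfolding I S by (simp add: algebra_simps)
qed

section \<open>Gluing two blocks\<close>

text \<open>
  Here \<open>ia / la\<close> and \<open>ja / la\<close> are the densities of two sets in the block \<open>a\<close> of size \<open>la\<close>, and
  \<open>ka\<close> is the size of their intersection there. After multiplication by \<open>l0 * l1\<close> the claim
  reduces to \<open>(i0 * l1 - i1 * l0) * (j0 * l1 - j1 * l0) \<ge> 0\<close>.
\<close>

lemma chebyshev_two_blocks: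
  fixes i0 i1 j0 j1 k0 k1 l0 l1 :: nat
  assumes pos: "0 < l0" "0 < l1"
    and i: "i1 * l0 \<le> i0 * l1" and j: "j1 * l0 \<le> j0 * l1"
    and k0: "i0 * j0 \<le> k0 * l0" and k1: "i1 * j1 \<le> k1 * l1"
  shows "(i0 + i1) * (j0 + j1) \<le> (k0 + k1) * (l0 + l1)"
proof -
  obtain a where a: "i0 * l1 = i1 * l0 + a"
    using i le_Suc_ex by blast
  obtain b where b: "j0 * l1 = j1 * l0 + b"
    using j le_Suc_ex by blast
  have "(i0 * l1) * (j1 * l0) + (i1 * l0) * (j0 * l1)
      \<le> (i0 * l1) * (j0 * l1) + (i1 * l0) * (j1 * l0)"
    unfolding a b by (simp add: algebra_simps)
  then have "(i0 + i1) * (j0 + j1) * (l0 * l1)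
      \<le> i0 * j0 * (l1 * (l0 + l1)) + i1 * j1 * (l0 * (l0 + l1))"
    by (simp add: algebra_simps)
  also have "\<dots> \<le> k0 * l0 * (l1 * (l0 + l1)) + k1 * l1 * (l0 * (l0 + l1))"
    by (intro add_mono mult_right_mono k0 k1) simp_all
  also have "\<dots> = (k0 + k1) * (l0 + l1) * (l0 * l1)"
    by (simp add: algebra_simps)
  finally show ?thesis
    using pos by simp
qed

section \<open>Splitting a sublattice at a coatom\<close>

definition sublattice :: "'a::lattice set \<Rightarrow> bool" where
  "sublattice S \<longleftrightarrow> (\<forall>x\<in>S. \<forall>y\<in>S. inf x y \<in> S \<and> sup x y \<in> S)"

text \<open>
  Take the top \<open>t\<close> of \<open>S\<close> and a maximal element \<open>m\<close> of the rest. If \<open>x\<close> is not below \<open>m\<close>,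
  then \<open>sup x m\<close> is strictly above \<open>m\<close>, which leaves only \<open>t\<close>.
\<close>

lemma sublattice_obtains_coatom:
  fixes S :: "'a::lattice set"
  assumes S: "sublattice S" "finite S" and card: "2 \<le> card S"
  obtains m t where "m \<in> S" "t \<in> S" "m < t" "\<And>x. x \<in> S \<Longrightarrow> \<not> x \<le> m \<Longrightarrow> sup x m = t"
proof -
  have "S \<noteq> {}"
    using card by auto
  then obtain t where t: "t \<in> S" "\<forall>b\<in>S. t \<le> b \<longrightarrow> t = b"
    using finite_has_maximal[OF S(2)] by blast
  have top: "x \<le> t" if "x \<in> S" for x
    using t S(1) that unfolding sublattice_def by (metis sup_ge1 sup_ge2)
  have "S - {t} \<noteq> {}"
    using card t(1) card_mono[of "{t}" S] by auto
  then obtain m where m: "m \<in> S" "m \<noteq> t" "\<forall>b\<in>S - {t}. m \<le> b \<longrightarrow> m = b"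
    using finite_has_maximal[of "S - {t}"] S(2) by blast
  have "sup x m = t" if "x \<in> S" "\<not> x \<le> m" for x
    using m that S(1) unfolding sublattice_def by (metis Diff_iff singletonD sup_ge1 sup_ge2)
  moreover have "m < t"
    using top[OF m(1)] m(2) by simp
  ultimately show thesis
    using that m(1) t(1) by blast
qed

lemma sublattice_below: "sublattice S \<Longrightarrow> sublattice {x \<in> S. x \<le> m}"
  unfolding sublattice_def by (auto intro: le_infI1)

text \<open>
  Not lying below the coatom \<open>m\<close> means joining with \<open>m\<close> to the top, and
  \<open>sup (inf x y) m = inf (sup x m) (sup y m)\<close>.
\<close>

lemma sublattice_not_below_coatom:
  fixes m t :: "'a::distrib_lattice"
  assumes S: "sublattice S" and m: "m < t"
    and coatom: "\<And>x. x \<in> S \<Longrightarrow> \<not> x \<le> m \<Longrightarrow> sup x m = t"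
  shows "sublattice {x \<in> S. \<not> x \<le> m}"
  unfolding sublattice_def
proof (intro ballI conjI)
  fix x y
  assume "x \<in> {x \<in> S. \<not> x \<le> m}" "y \<in> {x \<in> S. \<not> x \<le> m}"
  then have x: "x \<in> S" "\<not> x \<le> m" and y: "y \<in> S" "\<not> y \<le> m"
    by auto
  have "sup (inf x y) m = inf (sup x m) (sup y m)"
    by (rule sup_inf_distrib2)
  also have "\<dots> = t"
    using coatom x y by simp
  finally have "\<not> inf x y \<le> m"
    using m by (metis less_irrefl sup.absorb2)
  then show "inf x y \<in> {x \<in> S. \<not> x \<le> m}"
    using S x y unfolding sublattice_def by simp
  show "sup x y \<in> {x \<in> S. \<not> x \<le> m}"
    using S x y unfolding sublattice_def by simp
qed

text \<open>
  In a distributive lattice an element is determined by its meet and its join with \<open>m\<close>, and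
  here the join is always \<open>t\<close>.
\<close>

lemma inf_coatom_inj_on:
  fixes m t :: "'a::distrib_lattice"
  assumes coatom: "\<And>x. x \<in> S \<Longrightarrow> \<not> x \<le> m \<Longrightarrow> sup x m = t"
  shows "inj_on (\<lambda>x. inf x m) {x \<in> S. \<not> x \<le> m}"
proof (rule inj_onI)
  fix x y
  assume "x \<in> {x \<in> S. \<not> x \<le> m}" "y \<in> {x \<in> S. \<not> x \<le> m}" and eq: "inf x m = inf y m"
  then have join: "sup x m = sup y m"
    using coatom by simp
  have "x = inf x (sup y m)"
    by (metis join inf_sup_absorb)
  also have "\<dots> = sup (inf x y) (inf y m)"
    by (simp add: inf_sup_distrib1 eq)
  also have "\<dots> = inf y (sup x m)"
    by (simp add: inf_sup_distrib1 inf_commute)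
  also have "\<dots> = y"
    by (metis join inf_sup_absorb)
  finally show "x = y" .
qed

text \<open>
  If \<open>u\<close> lies between some \<open>inf x m\<close> and \<open>m\<close>, then \<open>u\<close> is itself the meet of \<open>sup x u\<close> with \<open>m\<close>.
  So the image of the upper block is the trace of an upper ideal on the lower block.
\<close>

lemma inf_coatom_image:
  fixes m :: "'a::distrib_lattice"
  assumes S: "sublattice S" and m: "m \<in> S"
  shows "(\<lambda>x. inf x m) ` {x \<in> S. \<not> x \<le> m}
       = {u. \<exists>x\<in>S. \<not> x \<le> m \<and> inf x m \<le> u} \<inter> {x \<in> S. x \<le> m}"
proof (intro set_eqI iffI)
  fix u
  assume "u \<in> (\<lambda>x. inf x m) ` {x \<in> S. \<not> x \<le> m}"
  then show "u \<in> {u. \<exists>x\<in>S. \<not> x \<le> m \<and> inf x m \<le> u} \<inter> {x \<in> S. x \<le> m}"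
    using S m unfolding sublattice_def by auto
next
  fix u
  assume "u \<in> {u. \<exists>x\<in>S. \<not> x \<le> m \<and> inf x m \<le> u} \<inter> {x \<in> S. x \<le> m}"
  then obtain x where x: "x \<in> S" "\<not> x \<le> m" "inf x m \<le> u" and u: "u \<in> S" "u \<le> m"
    by auto
  have "inf (sup x u) m = sup (inf x m) (inf u m)"
    by (rule inf_sup_distrib2)
  also have "\<dots> = u"
    using x(3) u(2) by (simp add: inf_absorb1 sup_absorb2)
  finally have "u = inf (sup x u) m" ..
  moreover have "sup x u \<in> {x \<in> S. \<not> x \<le> m}"
    using S x u unfolding sublattice_def by simp
  ultimately show "u \<in> (\<lambda>x. inf x m) ` {x \<in> S. \<not> x \<le> m}"
    by blast
qed

section \<open>Positive correlation of lower ideals\<close>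

text \<open>
  The hypothesis \<open>corr\<close> is the correlation inequality in the lower block, to be supplied by the
  induction. Moving the upper block down by \<open>x \<mapsto> inf x m\<close> keeps its size, keeps the elements
  of the lower ideal \<open>I\<close> inside \<open>I\<close>, and produces an upper set \<open>U\<close> of the lower block, which is
  negatively correlated with \<open>I\<close>.
\<close>

lemma density_above_coatom_le:
  fixes m t :: "'a::distrib_lattice"
  assumes S: "sublattice S" "finite S" and m: "m \<in> S"
    and coatom: "\<And>x. x \<in> S \<Longrightarrow> \<not> x \<le> m \<Longrightarrow> sup x m = t"
    and I: "lower_order_ideal I"
    and corr: "\<And>D. lower_order_ideal D \<Longrightarrow>
      card (I \<inter> {x \<in> S. x \<le> m}) * card (D \<inter> {x \<in> S. x \<le> m})
        \<le> card (I \<inter> D \<inter> {x \<in> S. x \<le> m}) * card {x \<in> S. x \<le> m}"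
  shows "card (I \<inter> {x \<in> S. \<not> x \<le> m}) * card {x \<in> S. x \<le> m}
       \<le> card (I \<inter> {x \<in> S. x \<le> m}) * card {x \<in> S. \<not> x \<le> m}"
proof -
  define S0 where "S0 = {x \<in> S. x \<le> m}"
  define S1 where "S1 = {x \<in> S. \<not> x \<le> m}"
  define U where "U = {u. \<exists>x\<in>S. \<not> x \<le> m \<and> inf x m \<le> u}"
  have fin: "finite S0"
    using S(2) unfolding S0_def by simp
  have inj: "inj_on (\<lambda>x. inf x m) S1"
    unfolding S1_def using coatom by (rule inf_coatom_inj_on)
  have image: "(\<lambda>x. inf x m) ` S1 = U \<inter> S0"
    unfolding S0_def S1_def U_def using S(1) m by (rule inf_coatom_image)
  have "(\<lambda>x. inf x m) ` (I \<inter> S1) \<subseteq> I \<inter> U \<inter> S0"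
    using I image unfolding lower_order_ideal_def by (blast intro: inf_le1)
  then have "card ((\<lambda>x. inf x m) ` (I \<inter> S1)) \<le> card (I \<inter> U \<inter> S0)"
    by (rule card_mono[rotated]) (use fin in simp)
  moreover have "card ((\<lambda>x. inf x m) ` (I \<inter> S1)) = card (I \<inter> S1)"
    by (rule card_image) (use inj in \<open>auto intro: inj_on_subset\<close>)
  ultimately have "card (I \<inter> S1) * card S0 \<le> card (I \<inter> U \<inter> S0) * card S0"
    by simp
  also have "upper_order_ideal U"
    unfolding upper_order_ideal_def U_def by (blast intro: order_trans)
  then have "card (I \<inter> U \<inter> S0) * card S0 \<le> card (I \<inter> S0) * card (U \<inter> S0)"
    using corr[of "- U"] card_correlation_Compl[OF fin, of I U]
    unfolding S0_def lower_order_ideal_Compl by blast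
  also have "card (U \<inter> S0) = card S1"
    using card_image[OF inj] image by simp
  finally show ?thesis
    unfolding S0_def S1_def .
qed

lemma lower_order_ideals_correlated:
  fixes S I J :: "'a::distrib_lattice set"
  assumes "finite S" "sublattice S" and I: "lower_order_ideal I" and J: "lower_order_ideal J"
  shows "card (I \<inter> S) * card (J \<inter> S) \<le> card (I \<inter> J \<inter> S) * card S"
  using assms
proof (induction "card S" arbitrary: S I J rule: less_induct)
  case less
  note S = less.prems(1,2) and I = less.prems(3) and J = less.prems(4)
  show ?case
  proof (cases "2 \<le> card S")
    case False
    then have "card S = 0 \<or> card S = 1"
      by linarith
    then have "S = {} \<or> (\<exists>a. S = {a})"
      using S(1) by (simp add: card_1_singleton_iff)
    then show ?thesis
      by (auto simp: Int_insert_right)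
  next
    case True
    obtain m t where m: "m \<in> S" and t: "t \<in> S" and mt: "m < t"
      and coatom: "\<And>x. x \<in> S \<Longrightarrow> \<not> x \<le> m \<Longrightarrow> sup x m = t"
      using sublattice_obtains_coatom[OF S(2,1) True] by blast
    define S0 where "S0 = {x \<in> S. x \<le> m}"
    define S1 where "S1 = {x \<in> S. \<not> x \<le> m}"
    have fin: "finite S0" "finite S1"
      using S(1) unfolding S0_def S1_def by simp_all
    have split: "card (A \<inter> S) = card (A \<inter> S0) + card (A \<inter> S1)" for A
    proof -
      have "A \<inter> S = (A \<inter> S0) \<union> (A \<inter> S1)" "(A \<inter> S0) \<inter> (A \<inter> S1) = {}"
        unfolding S0_def S1_def by auto
      then show ?thesis
        using fin by (simp add: card_Un_disjoint)
    qed
    have "m \<in> S0" "t \<in> S1"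
      using m t mt unfolding S0_def S1_def by auto
    then have pos: "0 < card S0" "0 < card S1"
      using fin by (auto simp: card_gt_0_iff)
    have card_S: "card S = card S0 + card S1"
      using split[of UNIV] by simp
    have small: "card S0 < card S" "card S1 < card S"
      using pos card_S by simp_all
    have sub0: "sublattice S0"
      unfolding S0_def using S(2) by (rule sublattice_below)
    have sub1: "sublattice S1"
      unfolding S1_def using S(2) mt coatom by (rule sublattice_not_below_coatom)
    have corr0: "card (A \<inter> S0) * card (D \<inter> S0) \<le> card (A \<inter> D \<inter> S0) * card S0"
      if "lower_order_ideal A" "lower_order_ideal D" for A D
      using less.hyps[OF small(1) fin(1) sub0 that] .
    have corr1: "card (I \<inter> S1) * card (J \<inter> S1) \<le> card (I \<inter> J \<inter> S1) * card S1"
      using less.hyps[OF small(2) fin(2) sub1 I J] .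
    have density: "card (A \<inter> S1) * card S0 \<le> card (A \<inter> S0) * card S1"
      if A: "lower_order_ideal A" for A
      unfolding S0_def S1_def
    proof (rule density_above_coatom_le[OF S(2,1) m _ A])
      show "sup x m = t" if "x \<in> S" "\<not> x \<le> m" for x
        using coatom that .
    qed (rule corr0[OF A, unfolded S0_def])
    show ?thesis
      unfolding split card_S
      using chebyshev_two_blocks[OF pos density[OF I] density[OF J] corr0[OF I J] corr1] .
  qed
qed

theorem lemma1p1:
  fixes I J :: "'a::{finite, distrib_lattice} set"
  shows "((lower_order_ideal I \<and> lower_order_ideal J) \<or> (upper_order_ideal I \<and> upper_order_ideal J)
            \<longrightarrow> card I * card J \<le> card (I \<inter> J) * card (UNIV :: 'a set))
       \<and> ((lower_order_ideal I \<and> upper_order_ideal J) \<or> (upper_order_ideal I \<and> lower_order_ideal J)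
            \<longrightarrow> card I * card J \<ge> card (I \<inter> J) * card (UNIV :: 'a set))"
proof -
  have sub: "sublattice (UNIV :: 'a set)"
    unfolding sublattice_def by simp
  have lower_lower: "card A * card B \<le> card (A \<inter> B) * card (UNIV :: 'a set)"
    if "lower_order_ideal A" "lower_order_ideal B" for A B :: "'a set"
    using lower_order_ideals_correlated[OF finite sub that] by simp
  have compl: "card A * card (- B) \<le> card (A \<inter> - B) * card (UNIV :: 'a set)
      \<longleftrightarrow> card (A \<inter> B) * card (UNIV :: 'a set) \<le> card A * card B" for A B :: "'a set"
    using card_correlation_Compl[of "UNIV :: 'a set" A B] by simp
  have lower_upper: "card (A \<inter> B) * card (UNIV :: 'a set) \<le> card A * card B"
    if "lower_order_ideal A" "upper_order_ideal B" for A B :: "'a set"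
    using lower_lower[of A "- B"] compl that by (simp add: lower_order_ideal_Compl)
  have upper_upper: "card A * card B \<le> card (A \<inter> B) * card (UNIV :: 'a set)"
    if "upper_order_ideal A" "upper_order_ideal B" for A B :: "'a set"
    using lower_upper[of "- A" B] compl[of B "- A"] that
    by (simp add: lower_order_ideal_Compl Int_commute mult.commute)
  show ?thesis
    using lower_lower upper_upper lower_upper[of I J] lower_upper[of J I]
    by (auto simp: Int_commute mult.commute)
qed

end
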